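(* Let $\mathcal{A}$ be an Artin group of (finite) crystallographic type with associated Coxeter group $\mathcal{C}$, root system $\Phi$ and simple roots $\Delta\subset\Phi$, let $\overline{F}:\mathcal{C}\to\mathbb{Z}^\Phi$ be the map defined in the context, and let $\Phi^+$ be the set of positive roots associated to the choice $\Delta$ of simple roots. Then for all $\phi\in\Phi^+$ and $c\in\mathcal{C}$, we have $\overline{F}(c)[\phi]\in\{0,1\}$, where $\overline{F}(c)[\phi]$ is the $\phi$ component of $\overline{F}(c)$.
   Context: Let $\Phi$ be a finite (reduced) crystallographic root system in a Euclidean space, with a choice of simple roots $\Delta\subset\Phi$. Its Weyl group $\mathcal{C}$ is generated by the reflections in the simple roots, and is a Coxeter group with these simple reflections as Coxeter generators. The associated Artin group $\mathcal{A}$ (called an Artin group of crystallographic type) is the group with one canonical generator $a$ for each simple root, denoted $\Delta_a$, and for each pair of distinct generators $a_1,a_2$ the braid relation $a_1a_2a_1\cdots=a_2a_1a_2\cdots$ with $m$ factors on each side, where $m$ is the order in $\mathcal{C}$ of the product of the corresponding simple reflections. The quotient map $\mathcal{A}\to\mathcal{C}$ sends $a$ to the reflection in the hyperplane orthogonal to $\Delta_a$; the image of $x\in\mathcal{A}$ is denoted $\mathcal{C}(x)$. $\mathbb{Z}^\Phi$ is the free abelian group with basis $(e_\phi)_{\phi\in\Phi}$, and $\mathcal{C}$ acts on it by $w\cdot e_\phi=e_{w\phi}$. The group law of $\mathbb{Z}^\Phi\rtimes\mathcal{C}$ is $(v,w)(v',w')=(v+w\cdot v',ww')$. $SGE:\mathcal{A}\to\mathbb{Z}^\Phi\rtimes\mathcal{C}$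 is the group homomorphism determined by $SGE(a)=(e_{\Delta_a},\mathcal{C}(a))$ for every canonical generator $a$. For $\ell\in\mathbb{Z}^\Phi$, $\overline{\ell}$ is the image of $\ell$ under the linear map $e_\phi\mapsto e_{-\phi}$. Define $F:\mathcal{A}\to\mathbb{Z}^\Phi$ by $F(x)=\ell-\overline{\ell}$ where $SGE(x)=(\ell,\mathcal{C}(x))$. The value $F(x)$ depends only on $\mathcal{C}(x)$, so $F$ descends to a map $\overline{F}:\mathcal{C}\to\mathbb{Z}^\Phi$ with $\overline{F}(\mathcal{C}(x))=F(x)$ for all $x\in\mathcal{A}$. *)

theory Defs
  imports "HOL-Analysis.Analysis" "HOL-Algebra.Bij" "HOL-Algebra.Generated_Groups"
    "HOL-Algebra.Multiplicative_Group" "HOL-Algebra.Free_Abelian_Groups"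
begin

section \<open>Root systems\<close>

definition reflect_along :: "'v::euclidean_space \<Rightarrow> 'v \<Rightarrow> 'v" where
  "reflect_along \<alpha> x = x - (2 * (x \<bullet> \<alpha>) / (\<alpha> \<bullet> \<alpha>)) *\<^sub>R \<alpha>"

text \<open>
  Finite, reduced and crystallographic. The roots are not required to span the ambient
  space, so that this covers both common conventions, and the empty root system as well.
\<close>

definition root_system :: "'v::euclidean_space set \<Rightarrow> bool" where
  "root_system \<Phi> \<longleftrightarrow>
     finite \<Phi> \<and> 0 \<notin> \<Phi> \<and>
     (\<forall>\<alpha>\<in>\<Phi>. reflect_along \<alpha> ` \<Phi> = \<Phi>) \<and>
     (\<forall>\<alpha>\<in>\<Phi>. \<forall>t. t *\<^sub>R \<alpha> \<in> \<Phi> \<longrightarrow> t = 1 \<or> t = -1) \<and>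
     (\<forall>\<alpha>\<in>\<Phi>. \<forall>\<beta>\<in>\<Phi>. 2 * (\<beta> \<bullet> \<alpha>) / (\<alpha> \<bullet> \<alpha>) \<in> \<int>)"

definition simple_roots :: "'v::euclidean_space set \<Rightarrow> 'v set \<Rightarrow> bool" where
  "simple_roots \<Phi> \<Delta> \<longleftrightarrow>
     \<Delta> \<subseteq> \<Phi> \<and> independent \<Delta> \<and>
     (\<forall>\<phi>\<in>\<Phi>. \<exists>k :: 'v \<Rightarrow> int. \<phi> = (\<Sum>\<delta>\<in>\<Delta>. of_int (k \<delta>) *\<^sub>R \<delta>) \<and>
        ((\<forall>\<delta>\<in>\<Delta>. 0 \<le> k \<delta>) \<or> (\<forall>\<delta>\<in>\<Delta>. k \<delta> \<le> 0)))"

definition positive_roots :: "'v::euclidean_space set \<Rightarrow> 'v set \<Rightarrow> 'v set" where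
  "positive_roots \<Phi> \<Delta> =
     {\<phi> \<in> \<Phi>. \<exists>k :: 'v \<Rightarrow> int. \<phi> = (\<Sum>\<delta>\<in>\<Delta>. of_int (k \<delta>) *\<^sub>R \<delta>) \<and> (\<forall>\<delta>\<in>\<Delta>. 0 \<le> k \<delta>)}"

text \<open>The multiplication inherited from \<^const>\<open>BijGroup\<close> is composition of maps.\<close>

definition weyl_group :: "'v::euclidean_space set \<Rightarrow> ('v \<Rightarrow> 'v) monoid" where
  "weyl_group \<Delta> =
     (BijGroup UNIV)\<lparr>carrier := generate (BijGroup UNIV) (reflect_along ` \<Delta>)\<rparr>"


section \<open>Groups given by generators and relations\<close>

text \<open>The letter \<open>(s, True)\<close> stands for the generator \<open>s\<close>, and \<open>(s, False)\<close> for its inverse.\<close>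

type_synonym 's word = "('s \<times> bool) list"

text \<open>The relations \<open>R\<close> are pairs of words in the letters of \<open>S\<close> that are to become equal.\<close>

inductive pres_cong :: "'s set \<Rightarrow> ('s word \<times> 's word) set \<Rightarrow> 's word \<Rightarrow> 's word \<Rightarrow> bool"
  for S R where
  refl: "w \<in> lists (S \<times> UNIV) \<Longrightarrow> pres_cong S R w w"
| sym: "pres_cong S R u v \<Longrightarrow> pres_cong S R v u"
| trans: "pres_cong S R u v \<Longrightarrow> pres_cong S R v w \<Longrightarrow> pres_cong S R u w"
| append: "pres_cong S R u u' \<Longrightarrow> pres_cong S R v v' \<Longrightarrow> pres_cong S R (u @ v) (u' @ v')"
| cancel: "s \<in> S \<Longrightarrow> pres_cong S R [(s, b), (s, \<not> b)] []"
| rel: "(u, v) \<in> R \<Longrightarrow> pres_cong S R u v"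

definition pres_class :: "'s set \<Rightarrow> ('s word \<times> 's word) set \<Rightarrow> 's word \<Rightarrow> 's word set" where
  "pres_class S R w = {v. pres_cong S R w v}"

definition presented_group :: "'s set \<Rightarrow> ('s word \<times> 's word) set \<Rightarrow> 's word set monoid" where
  "presented_group S R =
     \<lparr>carrier = pres_class S R ` lists (S \<times> UNIV),
      mult = (\<lambda>A B. \<Union>x\<in>A. \<Union>y\<in>B. pres_class S R (x @ y)),
      one = pres_class S R []\<rparr>"


section \<open>Artin groups of crystallographic type\<close>

fun alternating :: "nat \<Rightarrow> 's \<Rightarrow> 's \<Rightarrow> 's word" where
  "alternating 0 a b = []"
| "alternating (Suc n) a b = (a, True) # alternating n b a"

definition coxeter_entry :: "'v::euclidean_space set \<Rightarrow> 'v \<Rightarrow> 'v \<Rightarrow> nat" where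
  "coxeter_entry \<Delta> a b =
     group.ord (weyl_group \<Delta>) (reflect_along a \<otimes>\<^bsub>weyl_group \<Delta>\<^esub> reflect_along b)"

definition braid_relations :: "'v::euclidean_space set \<Rightarrow> ('v word \<times> 'v word) set" where
  "braid_relations \<Delta> =
     {(alternating (coxeter_entry \<Delta> a b) a b, alternating (coxeter_entry \<Delta> a b) b a) | a b.
        a \<in> \<Delta> \<and> b \<in> \<Delta> \<and> a \<noteq> b}"

text \<open>The canonical generators are indexed by the simple roots themselves.\<close>

definition artin_group :: "'v::euclidean_space set \<Rightarrow> 'v word set monoid" where
  "artin_group \<Delta> = presented_group \<Delta> (braid_relations \<Delta>)"

definition artin_gen :: "'v::euclidean_space set \<Rightarrow> 'v \<Rightarrow> 'v word set" where
  "artin_gen \<Delta> a = pres_class \<Delta> (braid_relations \<Delta>) [(a, True)]"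

text \<open>
  The homomorphism determined by its values \<open>f a\<close> on the canonical generators; asking for
  \<^const>\<open>extensional\<close> fixes the irrelevant values outside the carrier.
\<close>

definition artin_hom ::
  "'v::euclidean_space set \<Rightarrow> ('g, 'm) monoid_scheme \<Rightarrow> ('v \<Rightarrow> 'g) \<Rightarrow> 'v word set \<Rightarrow> 'g" where
  "artin_hom \<Delta> G f =
     (THE h. h \<in> hom (artin_group \<Delta>) G \<and> h \<in> extensional (carrier (artin_group \<Delta>)) \<and>
        (\<forall>a\<in>\<Delta>. h (artin_gen \<Delta> a) = f a))"

definition artin_to_weyl :: "'v::euclidean_space set \<Rightarrow> 'v word set \<Rightarrow> 'v \<Rightarrow> 'v" where
  "artin_to_weyl \<Delta> = artin_hom \<Delta> (weyl_group \<Delta>) reflect_along"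


section \<open>The homomorphism SGE and the map F\<close>

text \<open>
  The free abelian group on \<open>\<Phi>\<close> is the library's \<^const>\<open>free_Abelian_group\<close>, with basis
  vectors \<^term>\<open>frag_of \<phi>\<close>.
\<close>

definition weyl_act :: "('v \<Rightarrow> 'v) \<Rightarrow> ('v \<Rightarrow>\<^sub>0 int) \<Rightarrow> ('v \<Rightarrow>\<^sub>0 int)" where
  "weyl_act w = frag_extend (\<lambda>\<phi>. frag_of (w \<phi>))"

definition sge_target ::
  "'v::euclidean_space set \<Rightarrow> 'v set \<Rightarrow> (('v \<Rightarrow>\<^sub>0 int) \<times> ('v \<Rightarrow> 'v)) monoid" where
  "sge_target \<Phi> \<Delta> =
     \<lparr>carrier = carrier (free_Abelian_group \<Phi>) \<times> carrier (weyl_group \<Delta>),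
      mult = (\<lambda>(v, w) (v', w'). (v + weyl_act w v', w \<otimes>\<^bsub>weyl_group \<Delta>\<^esub> w')),
      one = (0, \<one>\<^bsub>weyl_group \<Delta>\<^esub>)\<rparr>"

definition SGE ::
  "'v::euclidean_space set \<Rightarrow> 'v set \<Rightarrow> 'v word set \<Rightarrow> ('v \<Rightarrow>\<^sub>0 int) \<times> ('v \<Rightarrow> 'v)" where
  "SGE \<Phi> \<Delta> =
     artin_hom \<Delta> (sge_target \<Phi> \<Delta>) (\<lambda>a. (frag_of a, artin_to_weyl \<Delta> (artin_gen \<Delta> a)))"

definition negate_basis :: "('v::euclidean_space \<Rightarrow>\<^sub>0 int) \<Rightarrow> ('v \<Rightarrow>\<^sub>0 int)" where
  "negate_basis = frag_extend (\<lambda>\<phi>. frag_of (- \<phi>))"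

definition F_map :: "'v::euclidean_space set \<Rightarrow> 'v set \<Rightarrow> 'v word set \<Rightarrow> ('v \<Rightarrow>\<^sub>0 int)" where
  "F_map \<Phi> \<Delta> x = fst (SGE \<Phi> \<Delta> x) - negate_basis (fst (SGE \<Phi> \<Delta> x))"

definition F_bar :: "'v::euclidean_space set \<Rightarrow> 'v set \<Rightarrow> ('v \<Rightarrow> 'v) \<Rightarrow> ('v \<Rightarrow>\<^sub>0 int)" where
  "F_bar \<Phi> \<Delta> c =
     (THE v. \<forall>x\<in>carrier (artin_group \<Delta>). artin_to_weyl \<Delta> x = c \<longrightarrow> F_map \<Phi> \<Delta> x = v)"

end

theory Submission
  imports Defs
begin

text \<open>
  Write \<open>P\<close> for the sum of the basis vectors \<open>e\<^bsub>\<phi>\<^esub>\<close> over the positive roots. The map \<open>F\<close> satisfies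
  \<open>F (x y) = F x + x F y\<close>, where \<open>x\<close> acts through its image in the Weyl group, because the action
  commutes with \<open>\<phi> \<mapsto> - \<phi>\<close>. The map sending \<open>x\<close> to \<open>P - x P\<close> satisfies the same equation. The two maps
  agree on a canonical generator \<open>a\<close>: the simple reflection \<open>s\<^sub>a\<close> permutes the positive roots
  other than \<open>a\<close> and sends \<open>a\<close> to \<open>- a\<close>, so both take the value \<open>e\<^sub>a - e\<^bsub>-a\<^esub>\<close>. Hence
  \<open>F x = P - x P\<close> everywhere. This shows that \<open>F\<close> descends to the Weyl group (\<open>F_bar_coboundary\<close>),
  and that for positive \<open>\<phi>\<close> the coefficient of \<open>e\<^bsub>\<phi>\<^esub>\<close> in its value at \<open>c\<close> is \<open>0\<close> if \<open>\<phi> = c \<psi>\<close>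
  for some positive \<open>\<psi>\<close>, and \<open>1\<close> otherwise.

  The definitions use definite descriptions, so \<open>SGE\<close> must be shown to exist, that is, the pairs
  \<open>(e\<^sub>a, s\<^sub>a)\<close> must satisfy the braid relations. The first component of the product of such pairs
  along a word is the sum of \<open>e\<^bsub>\<beta>\<^esub>\<close> over the root sequence of the word, and by the argument above the
  sum of \<open>e\<^bsub>\<beta>\<^esub> - e\<^bsub>-\<beta>\<^esub>\<close> over that sequence is \<open>P - w P\<close>, where \<open>w\<close> is the product of the word in the
  Weyl group. If the reflections in the roots of the sequence are distinct, no cancellation
  occurs, and the first component itself is determined by \<open>w\<close> (\<open>root_sequence_inversions\<close>).
  The reflections belonging to an alternating word in \<open>a\<close>, \<open>b\<close> are \<open>(s\<^sub>a s\<^sub>b)\<^sup>k s\<^sub>a\<close>; for a word whose length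
  is the order of \<open>s\<^sub>a s\<^sub>b\<close> they are distinct. As the two sides of a braid relation
  have the same product in the Weyl group, their values in the semidirect product agree.
\<close>

section \<open>Homomorphisms out of a presented group\<close>

definition word_eval :: "('g, 'm) monoid_scheme \<Rightarrow> ('s \<Rightarrow> 'g) \<Rightarrow> 's word \<Rightarrow> 'g" where
  "word_eval G f w =
     foldr (\<lambda>(s, b) y. (if b then f s else inv\<^bsub>G\<^esub> f s) \<otimes>\<^bsub>G\<^esub> y) w \<one>\<^bsub>G\<^esub>"

lemma word_eval_simps [simp]:
  "word_eval G f [] = \<one>\<^bsub>G\<^esub>"
  "word_eval G f ((s, b) # w) = (if b then f s else inv\<^bsub>G\<^esub> f s) \<otimes>\<^bsub>G\<^esub> word_eval G f w"
  by (simp_all add: word_eval_def)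

lemma pres_cong_in_lists:
  assumes "pres_cong S R u v" and "R \<subseteq> lists (S \<times> UNIV) \<times> lists (S \<times> UNIV)"
  shows "u \<in> lists (S \<times> UNIV) \<and> v \<in> lists (S \<times> UNIV)"
  using assms by (induction rule: pres_cong.induct) auto

lemma pres_class_eqI: "pres_cong S R u v \<Longrightarrow> pres_class S R u = pres_class S R v"
  unfolding pres_class_def by (auto intro: pres_cong.sym pres_cong.trans)

lemma pres_class_self: "w \<in> lists (S \<times> UNIV) \<Longrightarrow> w \<in> pres_class S R w"
  unfolding pres_class_def by (auto intro: pres_cong.refl)

lemma presented_group_mult:
  assumes "u \<in> lists (S \<times> UNIV)" "v \<in> lists (S \<times> UNIV)"
  shows "pres_class S R u \<otimes>\<^bsub>presented_group S R\<^esub> pres_class S R v = pres_class S R (u @ v)"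
proof -
  let ?A = "pres_class S R u" and ?B = "pres_class S R v"
  have "(\<Union>x\<in>?A. \<Union>y\<in>?B. pres_class S R (x @ y))
          = (\<Union>x\<in>?A. \<Union>y\<in>?B. pres_class S R (u @ v))"
  proof (intro SUP_cong HOL.refl)
    fix x y assume "x \<in> ?A" "y \<in> ?B"
    then have "pres_cong S R (u @ v) (x @ y)"
      unfolding pres_class_def by (simp add: pres_cong.append)
    then show "pres_class S R (x @ y) = pres_class S R (u @ v)"
      by (rule pres_class_eqI[symmetric])
  qed
  also have "\<dots> = pres_class S R (u @ v)"
    using pres_class_self[OF assms(1), of R] pres_class_self[OF assms(2), of R] by auto
  finally show ?thesis
    by (simp add: presented_group_def)
qed

locale presentation_map = group G for G (structure) +
  fixes S :: "'s set" and R :: "('s word \<times> 's word) set" and f :: "'s \<Rightarrow> 'a"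
  assumes relators: "R \<subseteq> lists (S \<times> UNIV) \<times> lists (S \<times> UNIV)"
    and gen_closed: "\<And>s. s \<in> S \<Longrightarrow> f s \<in> carrier G"
    and respects: "\<And>u v. (u, v) \<in> R \<Longrightarrow> word_eval G f u = word_eval G f v"
begin

lemma word_eval_closed: "w \<in> lists (S \<times> UNIV) \<Longrightarrow> word_eval G f w \<in> carrier G"
  by (induction w) (auto simp: gen_closed)

lemma word_eval_append:
  "u \<in> lists (S \<times> UNIV) \<Longrightarrow> v \<in> lists (S \<times> UNIV)
    \<Longrightarrow> word_eval G f (u @ v) = word_eval G f u \<otimes> word_eval G f v"
proof (induction u)
  case (Cons x u)
  obtain s b where x: "x = (s, b)" by (cases x)
  with Cons.prems have "s \<in> S" "u \<in> lists (S \<times> UNIV)" by auto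
  with Cons x show ?case
    by (simp add: gen_closed word_eval_closed m_assoc del: lists_eq_set)
qed (simp add: word_eval_closed)

lemma word_eval_cong: "pres_cong S R u v \<Longrightarrow> word_eval G f u = word_eval G f v"
proof (induction rule: pres_cong.induct)
  case (append u u' v v')
  then show ?case
    using pres_cong_in_lists[OF _ relators] by (metis word_eval_append)
next
  case (cancel s b)
  then show ?case by (cases b) (auto simp: gen_closed)
next
  case (rel u v)
  then show ?case by (rule respects)
qed simp_all

lemma hom_eq_word_eval:
  assumes h: "h \<in> hom (presented_group S R) G"
    and gen: "\<And>s. s \<in> S \<Longrightarrow> h (pres_class S R [(s, True)]) = f s"
    and w: "w \<in> lists (S \<times> UNIV)"
  shows "h (pres_class S R w) = word_eval G f w"
proof -
  have closed: "h (pres_class S R u) \<in> carrier G" if "u \<in> lists (S \<times> UNIV)" for u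
    using h that by (auto simp: hom_def presented_group_def)
  have mult: "h (pres_class S R (u @ v)) = h (pres_class S R u) \<otimes> h (pres_class S R v)"
    if "u \<in> lists (S \<times> UNIV)" "v \<in> lists (S \<times> UNIV)" for u v
    using h that by (auto simp: hom_def presented_group_def simp flip: presented_group_mult)
  have one: "h (pres_class S R []) = \<one>"
    using mult[of "[]" "[]"] closed[of "[]"] by simp
  have letter: "h (pres_class S R [(s, b)]) = (if b then f s else inv f s)" if s: "s \<in> S" for s b
  proof (cases b)
    case False
    have "h (pres_class S R [(s, False)]) \<otimes> f s = \<one>"
      using mult[of "[(s, False)]" "[(s, True)]"] s gen[OF s] one
        pres_class_eqI[OF pres_cong.cancel[of s S R False]]
      by simp
    then show ?thesis
      using False inv_equality[of _ "f s"] closed[of "[(s, False)]"] gen_closed[OF s] s by simp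
  qed (simp add: gen s)
  show ?thesis
    using w
  proof (induction w)
    case (Cons x w)
    obtain s b where x: "x = (s, b)" by (cases x)
    have s: "s \<in> S" and "[(s, b)] \<in> lists (S \<times> UNIV)" and "w \<in> lists (S \<times> UNIV)"
      using Cons.hyps x by auto
    then have "h (pres_class S R ([(s, b)] @ w)) = h (pres_class S R [(s, b)]) \<otimes> h (pres_class S R w)"
      by (intro mult)
    then show ?case
      by (simp add: x letter[OF s] Cons.IH)
  qed (simp add: one)
qed

text \<open>
  The universal property: since the defining relations hold between the images of the
  generators, \<open>f\<close> extends to exactly one homomorphism, so the definite description in
  \<^const>\<open>artin_hom\<close> denotes evaluation of words.
\<close>

lemma the_hom_eq_word_eval:
  assumes w: "w \<in> lists (S \<times> UNIV)"
  shows "(THE h. h \<in> hom (presented_group S R) G \<and>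
            h \<in> extensional (carrier (presented_group S R)) \<and>
            (\<forall>s\<in>S. h (pres_class S R [(s, True)]) = f s)) (pres_class S R w) = word_eval G f w"
proof -
  let ?C = "carrier (presented_group S R)"
  define h where
    "h = restrict (\<lambda>A. word_eval G f (SOME w. w \<in> lists (S \<times> UNIV) \<and> A = pres_class S R w)) ?C"
  have h: "h (pres_class S R u) = word_eval G f u" if u: "u \<in> lists (S \<times> UNIV)" for u
  proof -
    define w where "w = (SOME w. w \<in> lists (S \<times> UNIV) \<and> pres_class S R u = pres_class S R w)"
    have w: "w \<in> lists (S \<times> UNIV)" "pres_class S R u = pres_class S R w"
      using someI[of "\<lambda>w. w \<in> lists (S \<times> UNIV) \<and> pres_class S R u = pres_class S R w" u] u
      unfolding w_def by blast+
    have "pres_cong S R u w"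
      using pres_class_self[OF w(1), of R] unfolding w(2)[symmetric] by (simp add: pres_class_def)
    then have "word_eval G f w = word_eval G f u"
      by (rule word_eval_cong[symmetric])
    moreover have "pres_class S R u \<in> ?C"
      using u by (simp add: presented_group_def)
    ultimately show ?thesis
      by (simp add: h_def w_def)
  qed
  have hom: "h \<in> hom (presented_group S R) G"
  proof (rule homI)
    fix A assume "A \<in> ?C"
    then obtain u where u: "u \<in> lists (S \<times> UNIV)" and A: "A = pres_class S R u"
      by (auto simp: presented_group_def)
    show "h A \<in> carrier G"
      unfolding A h[OF u] by (rule word_eval_closed[OF u])
  next
    fix A B assume "A \<in> ?C" "B \<in> ?C"
    then obtain u v where uv: "u \<in> lists (S \<times> UNIV)" "v \<in> lists (S \<times> UNIV)"
      "A = pres_class S R u" "B = pres_class S R v"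
      by (auto simp: presented_group_def)
    then have "u @ v \<in> lists (S \<times> UNIV)" by simp
    with uv show "h (A \<otimes>\<^bsub>presented_group S R\<^esub> B) = h A \<otimes> h B"
      by (simp only: presented_group_mult h word_eval_append)
  qed
  have ext: "h \<in> extensional ?C"
    by (simp add: h_def)
  have gen: "\<forall>s\<in>S. h (pres_class S R [(s, True)]) = f s"
    by (simp add: h gen_closed)
  have "(THE h. h \<in> hom (presented_group S R) G \<and> h \<in> extensional ?C \<and>
            (\<forall>s\<in>S. h (pres_class S R [(s, True)]) = f s)) = h"
  proof (rule the_equality)
    fix k assume k: "k \<in> hom (presented_group S R) G \<and> k \<in> extensional ?C \<and>
            (\<forall>s\<in>S. k (pres_class S R [(s, True)]) = f s)"
    show "k = h"
    proof (rule extensionalityI)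
      fix A assume "A \<in> ?C"
      then obtain u where "u \<in> lists (S \<times> UNIV)" "A = pres_class S R u"
        by (auto simp: presented_group_def)
      then show "k A = h A"
        using hom_eq_word_eval[of k u] k h[of u] by simp
    qed (use k ext in auto)
  qed (use hom ext gen in blast)
  then show ?thesis
    using h[OF w] by simp
qed

end


section \<open>Reflections\<close>

lemma linear_reflect_along: "linear (reflect_along \<alpha>)"
  by (rule linearI)
    (simp_all add: reflect_along_def inner_add_left algebra_simps add_divide_distrib)

lemma reflect_along_involutive [simp]: "reflect_along \<alpha> (reflect_along \<alpha> x) = x"
proof (cases "\<alpha> = 0")
  case False
  then have "\<alpha> \<bullet> \<alpha> \<noteq> 0" by simp
  then show ?thesis
    by (simp add: reflect_along_def inner_diff_left algebra_simps)
qed (simp add: reflect_along_def)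

lemma reflect_along_comp_self [simp]: "reflect_along \<alpha> \<circ> reflect_along \<alpha> = id"
  by (simp add: fun_eq_iff)

lemma bij_reflect_along: "bij (reflect_along \<alpha>)"
  by (rule o_bij[of "reflect_along \<alpha>"]) simp_all

lemma reflect_along_self: "reflect_along \<alpha> \<alpha> = - \<alpha>"
  by (cases "\<alpha> = 0") (simp_all add: reflect_along_def scaleR_2)

lemma reflect_along_uminus: "reflect_along (- \<alpha>) = reflect_along \<alpha>"
  by (simp add: reflect_along_def fun_eq_iff)

lemma inner_reflect_along: "reflect_along \<alpha> x \<bullet> reflect_along \<alpha> y = x \<bullet> y"
proof (cases "\<alpha> = 0")
  case False
  then have "\<alpha> \<bullet> \<alpha> \<noteq> 0" by simp
  then show ?thesis
    by (simp add: reflect_along_def inner_diff_left inner_diff_right inner_commute field_simps)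
qed (simp add: reflect_along_def)

lemma reflect_along_reflected:
  "reflect_along (reflect_along \<alpha> \<beta>) = reflect_along \<alpha> \<circ> reflect_along \<beta> \<circ> reflect_along \<alpha>"
proof
  fix x
  let ?s = "reflect_along \<alpha>"
  have "x \<bullet> ?s \<beta> = ?s x \<bullet> \<beta>"
    using inner_reflect_along[of \<alpha> "?s x" \<beta>] by simp
  moreover have "?s (?s x - t *\<^sub>R \<beta>) = x - t *\<^sub>R ?s \<beta>" for t
    by (simp add: linear_diff[OF linear_reflect_along] linear_scale[OF linear_reflect_along])
  ultimately show "reflect_along (?s \<beta>) x = (?s \<circ> reflect_along \<beta> \<circ> ?s) x"
    by (simp add: reflect_along_def[of \<beta>] reflect_along_def[of "?s \<beta>"] inner_reflect_along)
qed


section \<open>Words in reflections and their root sequences\<close>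

definition reflection_product :: "'v::euclidean_space list \<Rightarrow> 'v \<Rightarrow> 'v" where
  "reflection_product as = foldr (\<lambda>a w. reflect_along a \<circ> w) as id"

lemma reflection_product_simps [simp]:
  "reflection_product [] = id"
  "reflection_product (a # as) = reflect_along a \<circ> reflection_product as"
  by (simp_all add: reflection_product_def)

lemma reflection_product_append:
  "reflection_product (as @ bs) = reflection_product as \<circ> reflection_product bs"
  by (induction as) (simp_all add: o_assoc)

lemma bij_reflection_product: "bij (reflection_product as)"
proof (induction as)
  case (Cons a as)
  then show ?case
    unfolding reflection_product_simps by (rule bij_comp[OF _ bij_reflect_along])
qed (simp only: reflection_product_simps bij_id)

text \<open>
  For \<open>a\<^sub>1 \<dots> a\<^sub>n\<close> these are the roots \<open>a\<^sub>1, s\<^sub>1 a\<^sub>2, s\<^sub>1 s\<^sub>2 a\<^sub>3, \<dots>\<close>. Their basis vectors sum to the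
  first component of the value of that word under \<^const>\<open>SGE\<close>.
\<close>

fun root_sequence :: "'v::euclidean_space list \<Rightarrow> 'v list" where
  "root_sequence [] = []"
| "root_sequence (a # as) = a # map (reflect_along a) (root_sequence as)"

fun alternating_list :: "nat \<Rightarrow> 's \<Rightarrow> 's \<Rightarrow> 's list" where
  "alternating_list 0 a b = []"
| "alternating_list (Suc n) a b = a # alternating_list n b a"

lemma set_alternating_list: "set (alternating_list n a b) \<subseteq> {a, b}"
  by (induction n a b rule: alternating_list.induct) auto

lemma alternating_eq: "alternating n a b = map (\<lambda>s. (s, True)) (alternating_list n a b)"
  by (induction n a b rule: alternating_list.induct) auto

lemma comp_funpow_shift: "f \<circ> (g \<circ> f) ^^ n = (f \<circ> g) ^^ n \<circ> f"
  by (induction n) (simp_all add: fun_eq_iff)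

text \<open>
  Taken at the order of \<open>s\<^sub>a s\<^sub>b\<close>, where the power is trivial, this is the braid relation between
  the two reflections.
\<close>

lemma reflection_product_alternating:
  "reflection_product (alternating_list n a b)
     = (reflect_along a \<circ> reflect_along b) ^^ n \<circ> reflection_product (alternating_list n b a)"
proof (induction n arbitrary: a b)
  case (Suc n)
  let ?s = "reflect_along a" and ?t = "reflect_along b"
  let ?w = "reflection_product (alternating_list n a b)"
  have "reflection_product (alternating_list (Suc n) a b) = (?s \<circ> (?t \<circ> ?s) ^^ n) \<circ> ?w"
    by (simp only: alternating_list.simps reflection_product_simps Suc[of b a] o_assoc)
  also have "\<dots> = (?s \<circ> ?t) ^^ n \<circ> ?s \<circ> (?t \<circ> ?t) \<circ> ?w"
    by (simp only: comp_funpow_shift reflect_along_comp_self comp_id)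
  also have "\<dots> = (?s \<circ> ?t) ^^ Suc n \<circ> (?t \<circ> ?w)"
    by (simp only: funpow_Suc_right o_assoc)
  finally show ?case by (simp only: alternating_list.simps reflection_product_simps)
qed simp

text \<open>
  Conjugating by \<open>s\<^sub>a\<close>, which is what the recursion of \<^const>\<open>root_sequence\<close> does to reflections,
  turns \<open>(s\<^sub>b s\<^sub>a)\<^sup>k s\<^sub>b\<close> into \<open>(s\<^sub>a s\<^sub>b)\<^bsup>k+1\<^esup> s\<^sub>a\<close>. Hence distinctness of these reflections is a statement
  about powers of \<open>s\<^sub>a s\<^sub>b\<close>.
\<close>

lemma reflections_of_alternating_roots:
  "map reflect_along (root_sequence (alternating_list n a b))
     = map (\<lambda>k. (reflect_along a \<circ> reflect_along b) ^^ k \<circ> reflect_along a) [0..<n]"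
proof (induction n arbitrary: a b)
  case (Suc n)
  let ?s = "reflect_along a" and ?t = "reflect_along b"
  have shift: "?s \<circ> ((?t \<circ> ?s) ^^ k \<circ> ?t) \<circ> ?s = (?s \<circ> ?t) ^^ Suc k \<circ> ?s" for k
    using comp_funpow_shift[where f = ?s and g = ?t and n = k] by (simp only: funpow_Suc_right o_assoc)
  have "map reflect_along (root_sequence (alternating_list (Suc n) a b))
          = ?s # map (\<lambda>g. ?s \<circ> g \<circ> ?s)
                   (map reflect_along (root_sequence (alternating_list n b a)))"
    by (simp add: reflect_along_reflected)
  also have "\<dots> = ?s # map (\<lambda>k. (?s \<circ> ?t) ^^ Suc k \<circ> ?s) [0..<n]"
    unfolding Suc[of b a] by (simp only: map_map shift comp_def[of "\<lambda>g. ?s \<circ> g \<circ> ?s"])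
  also have "\<dots> = map (\<lambda>k. (?s \<circ> ?t) ^^ k \<circ> ?s) (0 # map Suc [0..<n])"
    by simp
  also have "0 # map Suc [0..<n] = [0..<Suc n]"
    by (simp add: map_Suc_upt upt_conv_Cons del: upt_Suc)
  finally show ?case .
qed simp


section \<open>The action on the free abelian group\<close>

lemma weyl_act_simps [simp]:
  "weyl_act w 0 = 0"
  "weyl_act w (frag_of \<phi>) = frag_of (w \<phi>)"
  "weyl_act w (u + v) = weyl_act w u + weyl_act w v"
  "weyl_act w (u - v) = weyl_act w u - weyl_act w v"
  "weyl_act w (- v) = - weyl_act w v"
  by (simp_all add: weyl_act_def frag_extend_add frag_extend_diff frag_extend_minus)

lemma negate_basis_simps [simp]:
  "negate_basis 0 = 0"
  "negate_basis (frag_of \<phi>) = frag_of (- \<phi>)"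
  "negate_basis (u + v) = negate_basis u + negate_basis v"
  "negate_basis (- v) = - negate_basis v"
  by (simp_all add: negate_basis_def frag_extend_add frag_extend_minus)

lemma weyl_act_id [simp]: "weyl_act id v = v" "weyl_act (\<lambda>x. x) v = v"
  by (simp_all add: weyl_act_def frag_expansion[symmetric])

lemma weyl_act_comp: "weyl_act (w \<circ> w') v = weyl_act w (weyl_act w' v)"
  using frag_extend_compose[of "\<lambda>\<phi>. frag_of (w \<phi>)" w' v] by (simp add: weyl_act_def comp_def)

lemma weyl_act_sum:
  "finite A \<Longrightarrow> inj w \<Longrightarrow> weyl_act w (\<Sum>\<phi>\<in>A. frag_of \<phi>) = (\<Sum>\<phi>\<in>w ` A. frag_of \<phi>)"
  by (simp add: weyl_act_def frag_extend_sum sum.reindex inj_on_subset comp_def)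

lemma weyl_act_sum_list: "weyl_act w (sum_list vs) = sum_list (map (weyl_act w) vs)"
  by (induction vs) simp_all

lemma negate_basis_weyl_act:
  assumes "linear w"
  shows "negate_basis (weyl_act w v) = weyl_act w (negate_basis v)"
proof -
  have "negate_basis (weyl_act w v) = frag_extend (\<lambda>\<phi>. frag_of (- w \<phi>)) v"
    using frag_extend_compose[of "\<lambda>\<phi>. frag_of (- \<phi>)" w v]
    by (simp add: weyl_act_def negate_basis_def comp_def)
  also have "\<dots> = weyl_act w (negate_basis v)"
    using frag_extend_compose[of "\<lambda>\<phi>. frag_of (w \<phi>)" uminus v] linear_neg[OF assms]
    by (simp add: weyl_act_def negate_basis_def comp_def)
  finally show ?thesis .
qed

lemma lookup_sum_frag_of:
  "finite A \<Longrightarrow> Poly_Mapping.lookup (\<Sum>\<phi>\<in>A. frag_of \<phi>) \<psi> = (if \<psi> \<in> A then 1 else 0)"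
  by (simp add: lookup_sum)


section \<open>Positive roots\<close>

locale based_root_system =
  fixes \<Phi> \<Delta> :: "'v::euclidean_space set"
  assumes root_system: "root_system \<Phi>" and simple_roots: "simple_roots \<Phi> \<Delta>"
begin

abbreviation pos :: "'v set" where
  "pos \<equiv> positive_roots \<Phi> \<Delta>"

lemma finite_roots: "finite \<Phi>"
  and zero_not_root: "0 \<notin> \<Phi>"
  and reflect_roots: "\<alpha> \<in> \<Phi> \<Longrightarrow> reflect_along \<alpha> ` \<Phi> = \<Phi>"
  and reduced: "\<alpha> \<in> \<Phi> \<Longrightarrow> t *\<^sub>R \<alpha> \<in> \<Phi> \<Longrightarrow> t = 1 \<or> t = -1"
  using root_system by (simp_all add: root_system_def)

lemma simple_subset: "\<Delta> \<subseteq> \<Phi>"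
  and independent_simple: "independent \<Delta>"
  using simple_roots by (simp_all add: simple_roots_def)

lemma finite_simple: "finite \<Delta>"
  using finite_subset[OF simple_subset finite_roots] .

lemma pos_subset: "pos \<subseteq> \<Phi>"
  by (auto simp: positive_roots_def)

lemma finite_pos: "finite pos"
  using finite_subset[OF pos_subset finite_roots] .

lemma uminus_root: "\<phi> \<in> \<Phi> \<Longrightarrow> - \<phi> \<in> \<Phi>"
  using imageI[of \<phi> \<Phi> "reflect_along \<phi>"] by (simp add: reflect_roots reflect_along_self)

lemma simple_coeffs_unique:
  fixes k l :: "'v \<Rightarrow> real"
  assumes "(\<Sum>\<delta>\<in>\<Delta>. k \<delta> *\<^sub>R \<delta>) = (\<Sum>\<delta>\<in>\<Delta>. l \<delta> *\<^sub>R \<delta>)" and "\<delta> \<in> \<Delta>"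
  shows "k \<delta> = l \<delta>"
proof -
  have "(\<Sum>\<delta>\<in>\<Delta>. (k \<delta> - l \<delta>) *\<^sub>R \<delta>) = 0"
    using assms(1) by (simp add: scaleR_diff_left sum_subtractf)
  then have "k \<delta> - l \<delta> = 0"
    by (rule real_vector.independentD[OF independent_simple finite_simple subset_refl _ assms(2),
          where u = "\<lambda>\<delta>. k \<delta> - l \<delta>"])
  then show ?thesis by simp
qed

lemma multiple_of_simple:
  assumes "a \<in> \<Delta>"
  shows "t *\<^sub>R a = (\<Sum>\<delta>\<in>\<Delta>. (if \<delta> = a then t else 0) *\<^sub>R \<delta>)"
proof -
  have "(\<Sum>\<delta>\<in>\<Delta>. (if \<delta> = a then t else 0) *\<^sub>R \<delta>) = (\<Sum>\<delta>\<in>\<Delta>. if \<delta> = a then t *\<^sub>R \<delta> else 0)"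
    by (rule sum.cong) simp_all
  also have "\<dots> = t *\<^sub>R a"
    using assms finite_simple by simp
  finally show ?thesis by simp
qed

lemma simple_pos:
  assumes "a \<in> \<Delta>"
  shows "a \<in> pos"
proof -
  define k where "k \<delta> = (if \<delta> = a then 1 else 0 :: int)" for \<delta>
  have "a = (\<Sum>\<delta>\<in>\<Delta>. (if \<delta> = a then 1 else 0) *\<^sub>R \<delta>)"
    using multiple_of_simple[OF assms, of 1] by simp
  also have "\<dots> = (\<Sum>\<delta>\<in>\<Delta>. of_int (k \<delta>) *\<^sub>R \<delta>)"
    by (rule sum.cong) (simp_all add: k_def)
  finally have "a = (\<Sum>\<delta>\<in>\<Delta>. of_int (k \<delta>) *\<^sub>R \<delta>)" .
  moreover have "\<forall>\<delta>\<in>\<Delta>. 0 \<le> k \<delta>"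
    by (simp add: k_def)
  ultimately show ?thesis
    using assms simple_subset unfolding positive_roots_def by blast
qed

lemma uminus_simple_not_pos:
  assumes "a \<in> \<Delta>"
  shows "- a \<notin> pos"
proof
  assume "- a \<in> pos"
  then obtain k :: "'v \<Rightarrow> int"
    where k: "- a = (\<Sum>\<delta>\<in>\<Delta>. of_int (k \<delta>) *\<^sub>R \<delta>)" "\<forall>\<delta>\<in>\<Delta>. 0 \<le> k \<delta>"
    unfolding positive_roots_def by blast
  have "of_int (k a) = (if a = a then - 1 else (0::real))"
    using k(1) multiple_of_simple[OF assms, of "-1"] assms
    by (intro simple_coeffs_unique[of "\<lambda>\<delta>. of_int (k \<delta>)" "\<lambda>\<delta>. if \<delta> = a then - 1 else 0"]) simp_all
  then have "k a = - 1" by simp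
  then show False using k(2) assms by force
qed

text \<open>
  Reflecting in \<open>a\<close> changes only the \<open>a\<close>-coefficient of a root. A positive root other than \<open>a\<close>
  is no multiple of \<open>a\<close>, as the root system is reduced, so some other coefficient is positive.
  It survives, and a single positive coefficient makes a root positive.
\<close>

lemma reflect_simple_pos:
  assumes a: "a \<in> \<Delta>" and \<phi>: "\<phi> \<in> pos" "\<phi> \<noteq> a"
  shows "reflect_along a \<phi> \<in> pos - {a}"
proof -
  obtain k :: "'v \<Rightarrow> int"
    where k: "\<phi> = (\<Sum>\<delta>\<in>\<Delta>. of_int (k \<delta>) *\<^sub>R \<delta>)" "\<forall>\<delta>\<in>\<Delta>. 0 \<le> k \<delta>"
    using \<phi> unfolding positive_roots_def by blast
  have root: "reflect_along a \<phi> \<in> \<Phi>"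
    using reflect_roots[of a] a simple_subset \<phi>(1) pos_subset by blast
  obtain l :: "'v \<Rightarrow> int"
    where l: "reflect_along a \<phi> = (\<Sum>\<delta>\<in>\<Delta>. of_int (l \<delta>) *\<^sub>R \<delta>)"
      "(\<forall>\<delta>\<in>\<Delta>. 0 \<le> l \<delta>) \<or> (\<forall>\<delta>\<in>\<Delta>. l \<delta> \<le> 0)"
    using root simple_roots unfolding simple_roots_def by blast
  define t where "t = 2 * (\<phi> \<bullet> a) / (a \<bullet> a)"
  have "(\<Sum>\<delta>\<in>\<Delta>. (of_int (l \<delta>) + (if \<delta> = a then t else 0)) *\<^sub>R \<delta>) = reflect_along a \<phi> + t *\<^sub>R a"
    using l(1) multiple_of_simple[OF a, of t] by (simp add: scaleR_add_left sum.distrib)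
  also have "\<dots> = (\<Sum>\<delta>\<in>\<Delta>. of_int (k \<delta>) *\<^sub>R \<delta>)"
    using k(1) by (simp add: reflect_along_def t_def)
  finally have "of_int (l \<delta>) + (if \<delta> = a then t else 0) = of_int (k \<delta>)" if "\<delta> \<in> \<Delta>" for \<delta>
    by (rule simple_coeffs_unique[OF _ that])
  then have coeff: "l \<delta> = k \<delta>" if "\<delta> \<in> \<Delta>" "\<delta> \<noteq> a" for \<delta>
    using that by fastforce
  have "\<forall>\<delta>\<in>\<Delta>. 0 \<le> l \<delta>"
  proof (rule ccontr)
    assume "\<not> ?thesis"
    then have neg: "\<forall>\<delta>\<in>\<Delta>. l \<delta> \<le> 0" using l(2) by blast
    then have zero: "k \<delta> = 0" if "\<delta> \<in> \<Delta>" "\<delta> \<noteq> a" for \<delta>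
      using coeff[OF that] k(2) that by force
    have "\<phi> = (\<Sum>\<delta>\<in>\<Delta>. (if \<delta> = a then of_int (k a) else 0) *\<^sub>R \<delta>)"
      unfolding k(1) by (rule sum.cong) (auto simp: zero)
    then have multiple: "\<phi> = of_int (k a) *\<^sub>R a"
      using multiple_of_simple[OF a] by simp
    then have "of_int (k a) = (1::real) \<or> of_int (k a) = (-1::real)"
      using reduced[of a] \<phi>(1) pos_subset a simple_subset by blast
    then have "of_int (k a) = (1::real)"
      using k(2) a by force
    then show False using multiple \<phi>(2) by simp
  qed
  then have "reflect_along a \<phi> \<in> pos"
    using root l(1) unfolding positive_roots_def by blast
  moreover have "reflect_along a \<phi> \<noteq> a"
  proof
    assume "reflect_along a \<phi> = a"
    then have "\<phi> = - a"
      by (metis reflect_along_involutive reflect_along_self)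
    then show False using \<phi>(1) uminus_simple_not_pos[OF a] by simp
  qed
  ultimately show ?thesis by simp
qed

lemma reflect_simple_image:
  assumes a: "a \<in> \<Delta>"
  shows "reflect_along a ` pos = insert (- a) (pos - {a})"
proof -
  have "reflect_along a ` (pos - {a}) = pos - {a}"
  proof (rule subset_antisym)
    show sub: "reflect_along a ` (pos - {a}) \<subseteq> pos - {a}"
    proof (rule image_subsetI)
      fix \<phi> assume "\<phi> \<in> pos - {a}"
      then show "reflect_along a \<phi> \<in> pos - {a}"
        using reflect_simple_pos[OF a, of \<phi>] by simp
    qed
    have "reflect_along a ` reflect_along a ` (pos - {a}) \<subseteq> reflect_along a ` (pos - {a})"
      by (rule image_mono[OF sub])
    then show "pos - {a} \<subseteq> reflect_along a ` (pos - {a})"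
      by (simp add: image_image)
  qed
  moreover have "pos = insert a (pos - {a})"
    using simple_pos[OF a] by blast
  then have "reflect_along a ` pos = insert (reflect_along a a) (reflect_along a ` (pos - {a}))"
    by (metis image_insert)
  ultimately show ?thesis
    by (simp only: reflect_along_self)
qed

definition pos_sum :: "'v \<Rightarrow>\<^sub>0 int" where
  "pos_sum = (\<Sum>\<phi>\<in>pos. frag_of \<phi>)"

lemma pos_sum_simple:
  assumes a: "a \<in> \<Delta>"
  shows "pos_sum - weyl_act (reflect_along a) pos_sum = frag_of a - frag_of (- a)"
proof -
  have "weyl_act (reflect_along a) pos_sum = frag_of (- a) + (\<Sum>\<phi>\<in>pos - {a}. frag_of \<phi>)"
    using finite_pos uminus_simple_not_pos[OF a] bij_is_inj[OF bij_reflect_along[of a]]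
    by (simp add: pos_sum_def weyl_act_sum reflect_simple_image[OF a])
  moreover have "pos_sum = frag_of a + (\<Sum>\<phi>\<in>pos - {a}. frag_of \<phi>)"
    unfolding pos_sum_def by (rule sum.remove[OF finite_pos simple_pos[OF a]])
  ultimately show ?thesis by simp
qed

lemma lookup_pos_sum_diff:
  assumes "inj w"
  shows "Poly_Mapping.lookup (pos_sum - weyl_act w pos_sum) \<phi>
           = (if \<phi> \<in> pos then 1 else 0) - (if \<phi> \<in> w ` pos then 1 else 0)"
  using assms by (simp add: pos_sum_def weyl_act_sum finite_pos lookup_minus lookup_sum_frag_of)

lemma reflection_product_roots:
  "set as \<subseteq> \<Delta> \<Longrightarrow> reflection_product as ` \<Phi> = \<Phi>"
proof (induction as)
  case (Cons a as)
  then have "a \<in> \<Phi>" and "reflection_product as ` \<Phi> = \<Phi>"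
    using simple_subset by auto
  then show ?case
    by (simp only: reflection_product_simps image_comp[symmetric] reflect_roots)
qed simp

lemma root_sequence_roots: "set as \<subseteq> \<Delta> \<Longrightarrow> set (root_sequence as) \<subseteq> \<Phi>"
proof (induction as)
  case (Cons a as)
  then have "reflect_along a ` set (root_sequence as) \<subseteq> \<Phi>"
    using reflect_roots[of a] simple_subset by auto
  with Cons show ?case using simple_subset by auto
qed simp

text \<open>
  The map sending \<open>w\<close> to \<open>pos_sum - w pos_sum\<close> is a crossed homomorphism, as is the
  antisymmetrised sum over the root sequence, and both agree on simple reflections.
\<close>

lemma root_sequence_cocycle:
  assumes "set as \<subseteq> \<Delta>"
  defines "v \<equiv> sum_list (map frag_of (root_sequence as))"
  shows "v - negate_basis v = pos_sum - weyl_act (reflection_product as) pos_sum"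
  using assms(1) unfolding v_def
proof (induction as)
  case (Cons a as)
  let ?s = "reflect_along a"
  let ?v = "sum_list (map frag_of (root_sequence as))"
  have "sum_list (map frag_of (root_sequence (a # as))) = frag_of a + weyl_act ?s ?v"
    by (simp add: weyl_act_sum_list comp_def)
  moreover have "negate_basis (weyl_act ?s ?v) = weyl_act ?s (negate_basis ?v)"
    by (rule negate_basis_weyl_act[OF linear_reflect_along])
  moreover have "weyl_act ?s (?v - negate_basis ?v)
      = weyl_act ?s (pos_sum - weyl_act (reflection_product as) pos_sum)"
    using Cons by simp
  moreover have "frag_of a - frag_of (- a) = pos_sum - weyl_act ?s pos_sum"
    using Cons.prems by (simp add: pos_sum_simple)
  ultimately show ?case
    unfolding reflection_product_simps weyl_act_comp by (simp add: algebra_simps)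
qed simp

text \<open>
  If the reflections in the roots of the sequence are distinct, then no root occurs together
  with its negative, and so nothing cancels in the antisymmetrised sum of the previous lemma.
  The coefficient of \<open>\<phi>\<close> there is then \<open>1\<close> exactly for the roots of the sequence, while the other side
  of the equation attains \<open>1\<close> exactly on the inversion set. In particular all
  roots of the sequence are positive, and their sum depends only on the product of the word.
\<close>

lemma root_sequence_inversions:
  assumes as: "set as \<subseteq> \<Delta>" and dist: "distinct (map reflect_along (root_sequence as))"
  shows "sum_list (map frag_of (root_sequence as))
           = (\<Sum>\<phi>\<in>pos - reflection_product as ` pos. frag_of \<phi>)"
proof -
  let ?L = "set (root_sequence as)" and ?w = "reflection_product as"
  have distinct: "distinct (root_sequence as)" and inj: "inj_on reflect_along ?L"
    using dist by (simp_all add: distinct_map)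
  have sum: "sum_list (map frag_of (root_sequence as)) = (\<Sum>\<phi>\<in>?L. frag_of \<phi>)"
    by (rule sum_list_distinct_conv_sum_set[OF distinct])
  have neg: "- \<phi> \<notin> ?L" if "\<phi> \<in> ?L" for \<phi>
  proof
    assume "- \<phi> \<in> ?L"
    then have "- \<phi> = \<phi>"
      using inj_onD[OF inj reflect_along_uminus] that by blast
    then have "2 *\<^sub>R \<phi> = 0"
      unfolding scaleR_2 by (metis add.left_inverse)
    then have "\<phi> = 0" by simp
    then show False
      using zero_not_root root_sequence_roots[OF as] that by blast
  qed
  have "negate_basis (sum_list (map frag_of (root_sequence as))) = (\<Sum>\<phi>\<in>uminus ` ?L. frag_of \<phi>)"
    unfolding sum by (simp add: negate_basis_def frag_extend_sum sum.reindex comp_def)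
  then have "(\<Sum>\<phi>\<in>?L. frag_of \<phi>) - (\<Sum>\<phi>\<in>uminus ` ?L. frag_of \<phi>) = pos_sum - weyl_act ?w pos_sum"
    using root_sequence_cocycle[OF as] by (simp only: sum)
  then have "Poly_Mapping.lookup ((\<Sum>\<phi>\<in>?L. frag_of \<phi>) - (\<Sum>\<phi>\<in>uminus ` ?L. frag_of \<phi>)) \<phi>
      = (if \<phi> \<in> pos then 1 else 0) - (if \<phi> \<in> ?w ` pos then 1 else 0)" for \<phi>
    by (simp only: lookup_pos_sum_diff[OF bij_is_inj[OF bij_reflection_product]])
  then have coeff: "(if \<phi> \<in> ?L then 1 else 0) - (if \<phi> \<in> uminus ` ?L then 1 else 0)
      = (if \<phi> \<in> pos then 1 else 0) - (if \<phi> \<in> ?w ` pos then 1 else (0::int))" for \<phi>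
    by (simp only: lookup_minus lookup_sum_frag_of finite_set finite_imageI)
  have "\<phi> \<in> ?L \<longleftrightarrow> \<phi> \<in> pos - ?w ` pos" for \<phi>
  proof -
    have "\<phi> \<notin> ?L \<or> \<phi> \<notin> uminus ` ?L"
      using neg by force
    then show ?thesis
      using coeff[of \<phi>] by (simp split: if_splits)
  qed
  then have "?L = pos - ?w ` pos" by blast
  then show ?thesis using sum by simp
qed


section \<open>The Weyl group and its semidirect product with the free abelian group\<close>

abbreviation "W \<equiv> weyl_group \<Delta>"
abbreviation "T \<equiv> sge_target \<Phi> \<Delta>"

lemma BijGroup_UNIV:
  "carrier (BijGroup (UNIV :: 'v set)) = {w. bij w}"
  "\<one>\<^bsub>BijGroup (UNIV :: 'v set)\<^esub> = id"
  "bij u \<Longrightarrow> bij v \<Longrightarrow> u \<otimes>\<^bsub>BijGroup (UNIV :: 'v set)\<^esub> v = u \<circ> v"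
  by (auto simp: BijGroup_def Bij_def compose_def fun_eq_iff)

lemma group_weyl: "group W"
proof -
  interpret B: group "BijGroup (UNIV :: 'v set)" by (rule group_BijGroup)
  show ?thesis
    unfolding weyl_group_def
    by (intro B.subgroup_imp_group B.generate_is_subgroup)
      (auto simp: BijGroup_UNIV bij_reflect_along)
qed

lemma weyl_carrier: "carrier W = reflection_product ` lists \<Delta>"
proof (rule subset_antisym)
  interpret B: group "BijGroup (UNIV :: 'v set)" by (rule group_BijGroup)
  show "carrier W \<subseteq> reflection_product ` lists \<Delta>"
  proof
    fix w assume "w \<in> carrier W"
    then have "w \<in> generate (BijGroup UNIV) (reflect_along ` \<Delta>)"
      by (simp add: weyl_group_def)
    then show "w \<in> reflection_product ` lists \<Delta>"
    proof induction
      case one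
      then show ?case by (auto simp: BijGroup_UNIV intro!: image_eqI[of _ _ "[]"])
    next
      case (incl h)
      then obtain a where "a \<in> \<Delta>" "h = reflect_along a" by blast
      then show ?case by (auto intro!: image_eqI[of _ _ "[a]"])
    next
      case (inv h)
      then obtain a where a: "a \<in> \<Delta>" "h = reflect_along a" by blast
      then have "inv\<^bsub>BijGroup UNIV\<^esub> h = h"
        by (intro B.inv_equality) (simp_all add: BijGroup_UNIV bij_reflect_along)
      with a show ?case by (auto intro!: image_eqI[of _ _ "[a]"])
    next
      case (eng u v)
      then obtain as bs where "as \<in> lists \<Delta>" "bs \<in> lists \<Delta>"
        "u = reflection_product as" "v = reflection_product bs" by blast
      then show ?case
        by (auto simp: BijGroup_UNIV bij_reflection_product reflection_product_append
            intro!: image_eqI[of _ _ "as @ bs"])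
    qed
  qed
  have "reflection_product as \<in> generate (BijGroup UNIV) (reflect_along ` \<Delta>)"
    if "as \<in> lists \<Delta>" for as
    using that
  proof (induction as)
    case Nil
    show ?case
      unfolding reflection_product_simps(1) BijGroup_UNIV(2)[symmetric] by (rule generate.one)
  next
    case (Cons a as)
    then have "reflect_along a \<otimes>\<^bsub>BijGroup UNIV\<^esub> reflection_product as
        \<in> generate (BijGroup UNIV) (reflect_along ` \<Delta>)"
      by (intro generate.eng[OF generate.incl[OF imageI]])
    then show ?case
      by (simp only: reflection_product_simps BijGroup_UNIV bij_reflect_along
          bij_reflection_product)
  qed
  then show "reflection_product ` lists \<Delta> \<subseteq> carrier W"
    by (auto simp: weyl_group_def)
qed

lemma weyl_bij: "w \<in> carrier W \<Longrightarrow> bij w"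
  by (auto simp: weyl_carrier bij_reflection_product)

lemma weyl_roots: "w \<in> carrier W \<Longrightarrow> w ` \<Phi> = \<Phi>"
  using reflection_product_roots by (auto simp: weyl_carrier)

lemma reflect_in_weyl: "a \<in> \<Delta> \<Longrightarrow> reflect_along a \<in> carrier W"
  by (auto simp: weyl_carrier intro!: image_eqI[of _ _ "[a]"])

lemma reflection_product_in_weyl: "set as \<subseteq> \<Delta> \<Longrightarrow> reflection_product as \<in> carrier W"
  by (simp add: weyl_carrier lists_eq_set)

lemma weyl_one: "\<one>\<^bsub>W\<^esub> = id"
  using BijGroup_UNIV(2) by (simp add: weyl_group_def)

lemma weyl_mult: "u \<in> carrier W \<Longrightarrow> v \<in> carrier W \<Longrightarrow> u \<otimes>\<^bsub>W\<^esub> v = u \<circ> v"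
  using BijGroup_UNIV(3)[OF weyl_bij weyl_bij] by (simp add: weyl_group_def)

lemma weyl_act_mult:
  "u \<in> carrier W \<Longrightarrow> w \<in> carrier W \<Longrightarrow> weyl_act (u \<otimes>\<^bsub>W\<^esub> w) v = weyl_act u (weyl_act w v)"
  by (simp only: weyl_mult weyl_act_comp)

lemma weyl_pow: "w \<in> carrier W \<Longrightarrow> w [^]\<^bsub>W\<^esub> (n::nat) = w ^^ n"
proof (induction n)
  case (Suc n)
  interpret group W by (rule group_weyl)
  have "w [^]\<^bsub>W\<^esub> Suc n = w [^]\<^bsub>W\<^esub> n \<circ> w"
    using Suc.prems by (simp only: nat_pow_Suc weyl_mult nat_pow_closed)
  then show ?case
    using Suc by (simp only: funpow_Suc_right)
qed (simp add: weyl_one)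

lemma reflect_weyl_inv:
  assumes "a \<in> \<Delta>"
  shows "inv\<^bsub>W\<^esub> reflect_along a = reflect_along a"
proof -
  interpret group W by (rule group_weyl)
  show ?thesis
    using assms by (intro inv_equality) (simp_all add: weyl_mult reflect_in_weyl weyl_one)
qed

lemma sge_target_simps [simp]:
  "carrier T = {v. Poly_Mapping.keys v \<subseteq> \<Phi>} \<times> carrier W"
  "(v, w) \<otimes>\<^bsub>T\<^esub> (v', w') = (v + weyl_act w v', w \<otimes>\<^bsub>W\<^esub> w')"
  "\<one>\<^bsub>T\<^esub> = (0, id)"
  by (simp_all add: sge_target_def free_Abelian_group_def weyl_one)

lemma keys_weyl_act:
  assumes "w \<in> carrier W" "Poly_Mapping.keys v \<subseteq> \<Phi>"
  shows "Poly_Mapping.keys (weyl_act w v) \<subseteq> \<Phi>"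
proof -
  have "Poly_Mapping.keys (weyl_act w v) \<subseteq> w ` Poly_Mapping.keys v"
    unfolding weyl_act_def using keys_frag_extend[of "\<lambda>\<phi>. frag_of (w \<phi>)" v]
    by (auto simp: keys_frag_of)
  also have "\<dots> \<subseteq> \<Phi>"
    using weyl_roots[OF assms(1)] assms(2) by blast
  finally show ?thesis .
qed

lemma keys_plus_roots:
  "Poly_Mapping.keys u \<subseteq> \<Phi> \<Longrightarrow> Poly_Mapping.keys v \<subseteq> \<Phi> \<Longrightarrow> Poly_Mapping.keys (u + v) \<subseteq> \<Phi>"
  using keys_add[of u v] by blast

lemma group_sge_target: "group T"
proof -
  interpret W: group W by (rule group_weyl)
  show ?thesis
  proof (rule groupI)
    fix x y assume "x \<in> carrier T" "y \<in> carrier T"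
    then show "x \<otimes>\<^bsub>T\<^esub> y \<in> carrier T"
      by (cases x; cases y) (simp add: keys_plus_roots keys_weyl_act)
  next
    show "\<one>\<^bsub>T\<^esub> \<in> carrier T"
      using W.one_closed by (simp add: weyl_one)
  next
    fix x y z assume "x \<in> carrier T" "y \<in> carrier T" "z \<in> carrier T"
    then show "x \<otimes>\<^bsub>T\<^esub> y \<otimes>\<^bsub>T\<^esub> z = x \<otimes>\<^bsub>T\<^esub> (y \<otimes>\<^bsub>T\<^esub> z)"
      by (cases x; cases y; cases z) (simp add: W.m_assoc weyl_act_mult add.assoc)
  next
    fix x assume "x \<in> carrier T"
    then show "\<one>\<^bsub>T\<^esub> \<otimes>\<^bsub>T\<^esub> x = x"
      using W.l_one by (cases x) (simp add: weyl_one)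
  next
    fix x assume "x \<in> carrier T"
    then obtain v w where x: "x = (v, w)" "Poly_Mapping.keys v \<subseteq> \<Phi>" "w \<in> carrier W"
      by auto
    let ?y = "(- weyl_act (inv\<^bsub>W\<^esub> w) v, inv\<^bsub>W\<^esub> w)"
    have "?y \<in> carrier T"
      using x by (simp add: keys_weyl_act)
    moreover have "?y \<otimes>\<^bsub>T\<^esub> x = \<one>\<^bsub>T\<^esub>"
      using x W.l_inv[of w] by (simp add: weyl_one)
    ultimately show "\<exists>y\<in>carrier T. y \<otimes>\<^bsub>T\<^esub> x = \<one>\<^bsub>T\<^esub>"
      by blast
  qed
qed


section \<open>The braid relations\<close>

lemma braid_relations_words:
  "braid_relations \<Delta> \<subseteq> lists (\<Delta> \<times> UNIV) \<times> lists (\<Delta> \<times> UNIV)"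
  using set_alternating_list by (fastforce simp: braid_relations_def alternating_eq)

lemma word_eval_weyl_positive:
  "set as \<subseteq> \<Delta> \<Longrightarrow> word_eval W reflect_along (map (\<lambda>s. (s, True)) as) = reflection_product as"
  by (induction as) (auto simp: weyl_one weyl_mult reflect_in_weyl reflection_product_in_weyl)

lemma word_eval_sge_positive:
  assumes "set as \<subseteq> \<Delta>"
  shows "word_eval T (\<lambda>a. (frag_of a, reflect_along a)) (map (\<lambda>s. (s, True)) as)
           = (sum_list (map frag_of (root_sequence as)), reflection_product as)"
  using assms
proof (induction as)
  case (Cons a as)
  then have "reflection_product as \<in> carrier W"
    by (simp add: reflection_product_in_weyl)
  with Cons show ?case
    by (simp add: weyl_mult reflect_in_weyl weyl_act_sum_list comp_def)
qed simp

lemma reflection_product_braid: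
  assumes "a \<in> \<Delta>" "b \<in> \<Delta>"
  defines "m \<equiv> coxeter_entry \<Delta> a b"
  shows "reflection_product (alternating_list m a b) = reflection_product (alternating_list m b a)"
proof -
  interpret group W by (rule group_weyl)
  have "reflect_along a \<circ> reflect_along b \<in> carrier W"
    using m_closed[of "reflect_along a" "reflect_along b"] assms
    by (simp add: weyl_mult reflect_in_weyl)
  then have "(reflect_along a \<circ> reflect_along b) ^^ m = id"
    using pow_ord_eq_1[of "reflect_along a \<circ> reflect_along b"] assms
    by (simp add: weyl_pow weyl_mult reflect_in_weyl weyl_one coxeter_entry_def)
  then show ?thesis
    using reflection_product_alternating[of m a b] by simp
qed

text \<open>
  Two equal reflections would give two equal powers of \<open>s\<^sub>a s\<^sub>b\<close> with exponents below its order.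
  For an element of infinite order \<open>ord\<close> is \<open>0\<close>, and the word is then empty.
\<close>

lemma distinct_braid_reflections:
  assumes "a \<in> \<Delta>" "b \<in> \<Delta>"
  defines "m \<equiv> coxeter_entry \<Delta> a b"
  shows "distinct (map reflect_along (root_sequence (alternating_list m a b)))"
proof -
  interpret group W by (rule group_weyl)
  let ?u = "reflect_along a \<circ> reflect_along b"
  have u: "?u \<in> carrier W"
    using m_closed[of "reflect_along a" "reflect_along b"] assms
    by (simp add: weyl_mult reflect_in_weyl)
  have m: "m = ord ?u"
    using assms by (simp add: coxeter_entry_def weyl_mult reflect_in_weyl)
  have "inj_on (\<lambda>k. ?u ^^ k \<circ> reflect_along a) {0..<m}"
  proof (rule inj_onI)
    fix i j
    assume ij: "i \<in> {0..<m}" "j \<in> {0..<m}"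
      and eq: "?u ^^ i \<circ> reflect_along a = ?u ^^ j \<circ> reflect_along a"
    have "?u ^^ i = ?u ^^ i \<circ> reflect_along a \<circ> reflect_along a"
      by (simp add: comp_assoc)
    also have "\<dots> = ?u ^^ j"
      by (simp add: eq) (simp add: comp_assoc)
    finally have "?u [^]\<^bsub>W\<^esub> i = ?u [^]\<^bsub>W\<^esub> j"
      using u by (simp add: weyl_pow)
    then show "i = j"
      using inj_onD[OF ord_inj[OF u], of i j] ij by (auto simp: m)
  qed
  then show ?thesis
    by (simp add: reflections_of_alternating_roots distinct_map)
qed

lemma coxeter_entry_commute:
  assumes "a \<in> \<Delta>" "b \<in> \<Delta>"
  shows "coxeter_entry \<Delta> a b = coxeter_entry \<Delta> b a"
proof -
  interpret group W by (rule group_weyl)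
  have "inv\<^bsub>W\<^esub> (reflect_along a \<otimes>\<^bsub>W\<^esub> reflect_along b) = reflect_along b \<otimes>\<^bsub>W\<^esub> reflect_along a"
    using assms by (simp add: inv_mult_group reflect_in_weyl reflect_weyl_inv)
  then show ?thesis
    using ord_inv[of "reflect_along a \<otimes>\<^bsub>W\<^esub> reflect_along b"] assms
    by (simp add: coxeter_entry_def reflect_in_weyl)
qed

interpretation weyl_map: presentation_map W \<Delta> "braid_relations \<Delta>" reflect_along
proof (intro presentation_map.intro presentation_map_axioms.intro)
  show "group W" by (rule group_weyl)
  fix u v assume "(u, v) \<in> braid_relations \<Delta>"
  then obtain a b where ab: "a \<in> \<Delta>" "b \<in> \<Delta>"
    "u = alternating (coxeter_entry \<Delta> a b) a b" "v = alternating (coxeter_entry \<Delta> a b) b a"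
    unfolding braid_relations_def by blast
  then have "set (alternating_list n a b) \<subseteq> \<Delta>" "set (alternating_list n b a) \<subseteq> \<Delta>" for n
    using set_alternating_list by fast+
  with ab show "word_eval W reflect_along u = word_eval W reflect_along v"
    using reflection_product_braid[OF ab(1,2)]
    by (simp add: alternating_eq word_eval_weyl_positive)
qed (simp_all add: braid_relations_words reflect_in_weyl)

lemma artin_to_weyl_class:
  assumes "w \<in> lists (\<Delta> \<times> UNIV)"
  shows "artin_to_weyl \<Delta> (pres_class \<Delta> (braid_relations \<Delta>) w) = word_eval W reflect_along w"
  using weyl_map.the_hom_eq_word_eval[OF assms]
  by (simp add: artin_to_weyl_def artin_hom_def artin_group_def artin_gen_def)

lemma artin_to_weyl_gen: "a \<in> \<Delta> \<Longrightarrow> artin_to_weyl \<Delta> (artin_gen \<Delta> a) = reflect_along a"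
  by (simp add: artin_gen_def artin_to_weyl_class weyl_map.r_one reflect_in_weyl)

interpretation sge_map: presentation_map T \<Delta> "braid_relations \<Delta>"
  "\<lambda>a. (frag_of a, reflect_along a)"
proof (intro presentation_map.intro presentation_map_axioms.intro)
  show "group T" by (rule group_sge_target)
  show "(frag_of a, reflect_along a) \<in> carrier T" if "a \<in> \<Delta>" for a
    using that simple_subset by (auto simp: reflect_in_weyl keys_frag_of)
  fix u v assume "(u, v) \<in> braid_relations \<Delta>"
  then obtain a b where ab: "a \<in> \<Delta>" "b \<in> \<Delta>"
    "u = alternating (coxeter_entry \<Delta> a b) a b" "v = alternating (coxeter_entry \<Delta> a b) b a"
    unfolding braid_relations_def by blast
  then have sub: "set (alternating_list n a b) \<subseteq> \<Delta>" "set (alternating_list n b a) \<subseteq> \<Delta>" for n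
    using set_alternating_list by fast+
  define m where "m = coxeter_entry \<Delta> a b"
  have "distinct (map reflect_along (root_sequence (alternating_list m a b)))"
    using ab by (simp add: m_def distinct_braid_reflections)
  moreover have "distinct (map reflect_along (root_sequence (alternating_list m b a)))"
    using ab distinct_braid_reflections[of b a] by (simp add: m_def coxeter_entry_commute[of a b])
  ultimately show "word_eval T (\<lambda>a. (frag_of a, reflect_along a)) u
      = word_eval T (\<lambda>a. (frag_of a, reflect_along a)) v"
    using ab sub reflection_product_braid[of a b]
    by (simp add: alternating_eq word_eval_sge_positive root_sequence_inversions flip: m_def)
qed (rule braid_relations_words)

lemma SGE_class:
  assumes "w \<in> lists (\<Delta> \<times> UNIV)"
  shows "SGE \<Phi> \<Delta> (pres_class \<Delta> (braid_relations \<Delta>) w)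
           = word_eval T (\<lambda>a. (frag_of a, reflect_along a)) w"
proof -
  have "SGE \<Phi> \<Delta> = artin_hom \<Delta> T (\<lambda>a. (frag_of a, reflect_along a))"
    unfolding SGE_def artin_hom_def by (simp add: artin_to_weyl_gen cong: ball_cong)
  then show ?thesis
    using sge_map.the_hom_eq_word_eval[OF assms]
    by (simp add: artin_hom_def artin_group_def artin_gen_def)
qed


section \<open>The map F as a coboundary\<close>

lemma sge_gen_inv:
  assumes a: "a \<in> \<Delta>"
  shows "inv\<^bsub>T\<^esub> (frag_of a, reflect_along a) = (- frag_of (- a), reflect_along a)"
  using a simple_subset uminus_root[of a]
  by (intro sge_map.inv_equality)
    (auto simp: reflect_in_weyl keys_frag_of weyl_mult reflect_along_self)

text \<open>
  A generator and its inverse have first components \<open>e\<^sub>a\<close> and \<open>- e\<^bsub>-a\<^esub>\<close>, and \<open>v - negate_basis v\<close> has the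
  same value \<open>e\<^sub>a - e\<^bsub>-a\<^esub>\<close> for both. So every letter contributes alike to the induction, and negative
  letters behave just as they do in the Weyl group.
\<close>

lemma word_eval_sge_coboundary:
  assumes "w \<in> lists (\<Delta> \<times> UNIV)"
  shows "\<exists>v. word_eval T (\<lambda>a. (frag_of a, reflect_along a)) w = (v, word_eval W reflect_along w) \<and>
           v - negate_basis v = pos_sum - weyl_act (word_eval W reflect_along w) pos_sum"
  using assms
proof (induction w)
  case Nil
  then show ?case by (simp add: weyl_one id_def)
next
  case (Cons x w)
  obtain a b where x: "x = (a, b)" by (cases x)
  then have a: "a \<in> \<Delta>" and w: "w \<in> lists (\<Delta> \<times> UNIV)" using Cons.hyps by auto
  let ?s = "reflect_along a" and ?c = "word_eval W reflect_along w"
  obtain v where v: "word_eval T (\<lambda>a. (frag_of a, reflect_along a)) w = (v, ?c)"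
    and cob: "v - negate_basis v = pos_sum - weyl_act ?c pos_sum"
    using Cons.IH by blast
  let ?e = "if b then frag_of a else - frag_of (- a)"
  have c: "?c \<in> carrier W" by (rule weyl_map.word_eval_closed[OF w])
  have c': "word_eval W reflect_along (x # w) = ?s \<circ> ?c"
    using a c by (simp add: x reflect_weyl_inv weyl_mult reflect_in_weyl)
  have "word_eval T (\<lambda>a. (frag_of a, reflect_along a)) (x # w) = (?e + weyl_act ?s v, ?s \<circ> ?c)"
    using a c by (simp add: x v sge_gen_inv weyl_mult reflect_in_weyl)
  moreover
  have "weyl_act ?s (v - negate_basis v) = weyl_act ?s (pos_sum - weyl_act ?c pos_sum)"
    by (simp add: cob)
  then have "(?e + weyl_act ?s v) - negate_basis (?e + weyl_act ?s v)
      = pos_sum - weyl_act (?s \<circ> ?c) pos_sum"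
    using pos_sum_simple[OF a] negate_basis_weyl_act[OF linear_reflect_along, of a v]
    by (auto simp: weyl_act_comp algebra_simps)
  ultimately show ?case
    unfolding c' by blast
qed

lemma F_map_coboundary:
  assumes "x \<in> carrier (artin_group \<Delta>)"
  shows "F_map \<Phi> \<Delta> x = pos_sum - weyl_act (artin_to_weyl \<Delta> x) pos_sum"
proof -
  obtain w where w: "w \<in> lists (\<Delta> \<times> UNIV)" "x = pres_class \<Delta> (braid_relations \<Delta>) w"
    using assms by (auto simp: artin_group_def presented_group_def)
  then show ?thesis
    using word_eval_sge_coboundary[OF w(1)] by (auto simp: F_map_def SGE_class artin_to_weyl_class)
qed

text \<open>
  Without a preimage of \<open>c\<close> the description in \<^const>\<open>F_bar\<close> would be satisfied by every vector.
\<close>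

lemma artin_to_weyl_surj:
  assumes "c \<in> carrier W"
  obtains x where "x \<in> carrier (artin_group \<Delta>)" "artin_to_weyl \<Delta> x = c"
proof -
  obtain as where as: "as \<in> lists \<Delta>" "c = reflection_product as"
    using assms by (auto simp: weyl_carrier)
  let ?w = "map (\<lambda>s. (s, True)) as"
  have w: "?w \<in> lists (\<Delta> \<times> UNIV)" using as(1) by auto
  have "artin_to_weyl \<Delta> (pres_class \<Delta> (braid_relations \<Delta>) ?w) = c"
    using artin_to_weyl_class[OF w] as by (simp add: word_eval_weyl_positive in_lists_conv_set subset_iff)
  moreover have "pres_class \<Delta> (braid_relations \<Delta>) ?w \<in> carrier (artin_group \<Delta>)"
    using w by (simp add: artin_group_def presented_group_def)
  ultimately show ?thesis by (rule that[rotated])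
qed

lemma F_bar_coboundary:
  assumes "c \<in> carrier W"
  shows "F_bar \<Phi> \<Delta> c = pos_sum - weyl_act c pos_sum"
  unfolding F_bar_def
proof (rule the_equality)
  show "\<forall>x\<in>carrier (artin_group \<Delta>). artin_to_weyl \<Delta> x = c
      \<longrightarrow> F_map \<Phi> \<Delta> x = pos_sum - weyl_act c pos_sum"
    by (auto simp: F_map_coboundary)
  obtain x where "x \<in> carrier (artin_group \<Delta>)" "artin_to_weyl \<Delta> x = c"
    using artin_to_weyl_surj[OF assms] .
  then show "v = pos_sum - weyl_act c pos_sum"
    if "\<forall>x\<in>carrier (artin_group \<Delta>). artin_to_weyl \<Delta> x = c \<longrightarrow> F_map \<Phi> \<Delta> x = v" for v
    using that F_map_coboundary by auto
qed

end

theorem lemma5p3: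
  fixes \<Phi> \<Delta> :: "'v::euclidean_space set" and \<phi> :: 'v and c :: "'v \<Rightarrow> 'v"
  assumes "root_system \<Phi>"
    and "simple_roots \<Phi> \<Delta>"
    and "\<phi> \<in> positive_roots \<Phi> \<Delta>"
    and "c \<in> carrier (weyl_group \<Delta>)"
  shows "Poly_Mapping.lookup (F_bar \<Phi> \<Delta> c) \<phi> \<in> {0, 1}"
proof -
  interpret based_root_system \<Phi> \<Delta>
    using assms(1,2) by unfold_locales
  show ?thesis
    using assms(3,4) lookup_pos_sum_diff[OF bij_is_inj[OF weyl_bij], of c \<phi>]
    by (simp add: F_bar_coboundary)
qed

end
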